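(* Let $X$ be a Priestley space. Then the set $\mathsf{CC}(X)$ of nonempty closed chains of $X$ is a closed subset of the Vietoris space $\mathsf{V}(X)$.
   Context: A Priestley space is a compact space with a partial order such that $x\not\le y$ implies a clopen upset containing $x$ but not $y$. A chain is a totally ordered subset. $\mathsf{V}(X)$ is the set of nonempty closed subsets of $X$ with topology generated by $\Box V=\{F\mid F\subseteq V\}$ and $\Diamond V=\{F\mid F\cap V\ne\varnothing\}$ for $V$ clopen in $X$. *)

theory Defs
  imports "HOL-Analysis.Analysis"
begin

definition clopenin :: "'a topology \<Rightarrow> 'a set \<Rightarrow> bool" where
  "clopenin X U \<longleftrightarrow> closedin X U \<and> openin X U"

definition upset_on :: "'a set \<Rightarrow> 'a rel \<Rightarrow> 'a set \<Rightarrow> bool" where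
  "upset_on A r U \<longleftrightarrow> U \<subseteq> A \<and> (\<forall>x\<in>U. \<forall>y\<in>A. (x, y) \<in> r \<longrightarrow> y \<in> U)"

text \<open>The order is a relation on the points of the space; \<open>(x, y) \<in> r\<close> means \<open>x \<le> y\<close>.\<close>

definition priestley_space :: "'a topology \<Rightarrow> 'a rel \<Rightarrow> bool" where
  "priestley_space X r \<longleftrightarrow>
     compact_space X \<and>
     partial_order_on (topspace X) r \<and>
     (\<forall>x\<in>topspace X. \<forall>y\<in>topspace X. (x, y) \<notin> r \<longrightarrow>
        (\<exists>U. clopenin X U \<and> upset_on (topspace X) r U \<and> x \<in> U \<and> y \<notin> U))"

definition nonempty_closed_sets :: "'a topology \<Rightarrow> 'a set set" where
  "nonempty_closed_sets X = {F. closedin X F \<and> F \<noteq> {}}"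

definition vietoris_box :: "'a topology \<Rightarrow> 'a set \<Rightarrow> 'a set set" where
  "vietoris_box X V = {F \<in> nonempty_closed_sets X. F \<subseteq> V}"

definition vietoris_diamond :: "'a topology \<Rightarrow> 'a set \<Rightarrow> 'a set set" where
  "vietoris_diamond X V = {F \<in> nonempty_closed_sets X. F \<inter> V \<noteq> {}}"

definition vietoris_space :: "'a topology \<Rightarrow> 'a set topology" where
  "vietoris_space X = topology_generated_by
     ({vietoris_box X V | V. clopenin X V} \<union> {vietoris_diamond X V | V. clopenin X V})"

definition nonempty_closed_chains :: "'a topology \<Rightarrow> 'a rel \<Rightarrow> 'a set set" where
  "nonempty_closed_chains X r = {F \<in> nonempty_closed_sets X. F \<in> Chains r}"

text \<open>\<^const>\<open>topology_generated_by\<close> takes the union of the subbasis as carrier; here this is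
  all of \<open>V(X)\<close>, since \<^term>\<open>topspace X\<close> is clopen.\<close>

lemma topspace_vietoris_space: "topspace (vietoris_space X) = nonempty_closed_sets X"
proof
  show "topspace (vietoris_space X) \<subseteq> nonempty_closed_sets X"
    by (auto simp: vietoris_space_def vietoris_box_def vietoris_diamond_def)
  have "clopenin X (topspace X)"
    by (simp add: clopenin_def)
  moreover have "nonempty_closed_sets X = vietoris_box X (topspace X)"
    by (auto simp: vietoris_box_def nonempty_closed_sets_def dest: closedin_subset)
  ultimately show "nonempty_closed_sets X \<subseteq> topspace (vietoris_space X)"
    unfolding vietoris_space_def topology_generated_by_topspace by blast
qed

end

theory Submission
  imports Defs
begin

text \<open>If \<open>F\<close> contains incomparable \<open>x\<close> and \<open>y\<close>, pick clopen upsets \<open>U\<close> containing \<open>x\<close> but not \<open>y\<close>,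
  and \<open>V\<close> containing \<open>y\<close> but not \<open>x\<close>. Every point of \<open>U - V\<close> is incomparable to every point of
  \<open>V - U\<close>, so the sets meeting both differences form an open neighbourhood of \<open>F\<close> without chains.\<close>

lemma clopenin_diff:
  assumes "clopenin X U" "clopenin X V"
  shows "clopenin X (U - V)"
  using assms by (simp add: clopenin_def closedin_diff openin_diff)

lemma openin_vietoris_diamond:
  assumes "clopenin X V"
  shows "openin (vietoris_space X) (vietoris_diamond X V)"
  unfolding vietoris_space_def using assms by (blast intro: topology_generated_by_Basis)

text \<open>If \<open>a\<close> \<le> \<open>b\<close>, then \<open>b\<close>, a point of
  \<open>A\<close> because \<open>V\<close> \<subseteq> \<open>A\<close>, would lie in the upset
  \<open>U\<close>. Exchanging \<open>U\<close> and \<open>V\<close> excludes \<open>b\<close> \<le>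
  \<open>a\<close>.\<close>

lemma upset_on_diff_incomparable:
  assumes "upset_on A r U" "upset_on A r V" "a \<in> U - V" "b \<in> V - U"
  shows "(a, b) \<notin> r"
  using assms unfolding upset_on_def by blast

theorem theorem3p2:
  fixes X :: "'a topology" and r :: "'a rel"
  assumes "priestley_space X r"
  shows "closedin (vietoris_space X) (nonempty_closed_chains X r)"
proof -
  \<comment> \<open>By \<open>topspace_vietoris_space\<close> this is the complement within the
    whole carrier, so its openness is what closedness requires.\<close>
  let ?N = "nonempty_closed_sets X - nonempty_closed_chains X r"
  have "\<exists>W. openin (vietoris_space X) W \<and> F \<in> W \<and> W \<subseteq> ?N" if F: "F \<in> ?N" for F
  proof -
    have sub: "F \<subseteq> topspace X"
      using F by (auto simp: nonempty_closed_sets_def dest: closedin_subset)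
    obtain x y where xy: "x \<in> F" "y \<in> F" "(x, y) \<notin> r" "(y, x) \<notin> r"
      using F by (auto simp: nonempty_closed_chains_def Chains_def)
    obtain U where U: "clopenin X U" "upset_on (topspace X) r U" "x \<in> U" "y \<notin> U"
      using assms xy sub unfolding priestley_space_def by blast
    obtain V where V: "clopenin X V" "upset_on (topspace X) r V" "y \<in> V" "x \<notin> V"
      using assms xy sub unfolding priestley_space_def by blast
    let ?W = "vietoris_diamond X (U - V) \<inter> vietoris_diamond X (V - U)"
    have "openin (vietoris_space X) ?W"
      using U(1) V(1) by (intro openin_Int openin_vietoris_diamond clopenin_diff)
    \<comment> \<open>The point \<open>x\<close> witnesses that \<open>F\<close> meets
      \<open>U - V\<close>, and \<open>y\<close> that it meets \<open>V - U\<close>.\<close>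
    moreover have "F \<in> ?W"
      using F xy U V by (auto simp: vietoris_diamond_def)
    moreover have "?W \<subseteq> ?N"
    proof
      fix G assume G: "G \<in> ?W"
      then obtain a b where ab: "a \<in> G" "a \<in> U - V" "b \<in> G" "b \<in> V - U"
        unfolding vietoris_diamond_def by blast
      have "(a, b) \<notin> r" "(b, a) \<notin> r"
        using upset_on_diff_incomparable U(2) V(2) ab by metis+
      then show "G \<in> ?N"
        using G ab unfolding vietoris_diamond_def nonempty_closed_chains_def Chains_def by blast
    qed
    ultimately show ?thesis by blast
  qed
  then have "openin (vietoris_space X) ?N"
    by (subst openin_subopen) blast
  then show ?thesis
    by (auto simp: closedin_def topspace_vietoris_space nonempty_closed_chains_def)
qed

end
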